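(* For any $b\in\mathbb{R}\setminus\{0\}$, $$\sigma(b) = \tau,$$ where $$\sigma(b) = \inf\Big\{t>0 : \sum_{n\in\mathbb{Z}}\sum_{k\in\mathbb{N}} e^{-t(\frac12(bn)^2+k)}\|\Pi_{bn,k}\| < \infty\Big\}$$ and $\tau$ is the unique positive solution of $\coth\frac{\tau}{2} = \frac{\tau}{2}$.
   Context: $\mathbb{N}=\{0,1,2,\dots\}$. The Hermite functions are $h_k(y) = (2^k k!\sqrt{\pi})^{-1/2}\left(y-\frac{d}{dy}\right)^k e^{-y^2/2}$, regarded as entire functions of $y$. For $a\in\mathbb{R}$ the shifted harmonic oscillator $P_a=\frac12(-\partial_y^2+(y-ia)^2-1)$ on $L^2(\mathbb{R})$ has compact resolvent and spectrum $\mathbb{N}$; its spectral projection at the eigenvalue $k\in\mathbb{N}$ is the rank-one operator $$\Pi_{a,k}f(y) = \langle f, h_k(\cdot+ia)\rangle_{L^2(\mathbb{R})}\, h_k(y-ia),\qquad \langle f,g\rangle=\int_{\mathbb{R}} f\bar g\,dy.$$ $\|\Pi_{a,k}\|$ is the operator norm on $L^2(\mathbb{R})$. *)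

theory Defs
  imports "HOL-Analysis.Analysis"
begin

text \<open>The Hermite functions as entire functions of a complex variable.\<close>

definition hermite_fun :: "nat \<Rightarrow> complex \<Rightarrow> complex" where
  "hermite_fun k y =
     ((\<lambda>f z. z * f z - deriv f z) ^^ k) (\<lambda>z. exp (- z\<^sup>2 / 2)) y
       / of_real (sqrt (2 ^ k * fact k * sqrt pi))"

text \<open>
  Elements of $L^2(\mathbb{R})$ are represented by Borel measurable functions, not identified
  modulo null sets. The norm is extended by infinity to functions outside $L^2(\mathbb{R})$, so
  that the operator norm of a map that does not send $L^2(\mathbb{R})$ boundedly into itself is
  infinite.
\<close>

definition square_integrable :: "(real \<Rightarrow> complex) \<Rightarrow> bool" where
  "square_integrable f \<longleftrightarrow>
     f \<in> borel_measurable lborel \<and> integrable lborel (\<lambda>x. (cmod (f x))\<^sup>2)"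

definition L2_norm :: "(real \<Rightarrow> complex) \<Rightarrow> ennreal" where
  "L2_norm f =
     (if square_integrable f then ennreal (sqrt (LINT x|lborel. (cmod (f x))\<^sup>2)) else \<infinity>)"

definition L2_inner :: "(real \<Rightarrow> complex) \<Rightarrow> (real \<Rightarrow> complex) \<Rightarrow> complex" where
  "L2_inner f g = (LINT x|lborel. f x * cnj (g x))"

definition L2_opnorm :: "((real \<Rightarrow> complex) \<Rightarrow> real \<Rightarrow> complex) \<Rightarrow> ennreal" where
  "L2_opnorm T = (SUP f\<in>{f. square_integrable f \<and> L2_norm f \<le> 1}. L2_norm (T f))"

text \<open>
  The spectral projection, at the eigenvalue \<open>k\<close>, of the shifted harmonic oscillator
  $P_a = \frac12(-\partial_y^2 + (y - ia)^2 - 1)$, given by its explicit rank-one form.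
\<close>

definition spectral_proj :: "real \<Rightarrow> nat \<Rightarrow> (real \<Rightarrow> complex) \<Rightarrow> real \<Rightarrow> complex" where
  "spectral_proj a k f =
     (\<lambda>y. L2_inner f (\<lambda>x. hermite_fun k (of_real x + \<i> * of_real a))
          * hermite_fun k (of_real y - \<i> * of_real a))"

text \<open>
  Both the double series and the infimum are taken in extended numbers: a divergent series has
  the value infinity, and the infimum over an empty set of times is infinity.
\<close>

definition sigma_time :: "real \<Rightarrow> ereal" where
  "sigma_time b = Inf (ereal ` {t. t > 0 \<and>
     (\<Sum>\<^sub>\<infinity>n::int. \<Sum>\<^sub>\<infinity>k::nat.
        ennreal (exp (- t * ((b * of_int n)\<^sup>2 / 2 + of_nat k)))
          * L2_opnorm (spectral_proj (b * of_int n) k)) < \<infinity>})"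

definition coth :: "real \<Rightarrow> real" where
  "coth x = cosh x / sinh x"

definition tau :: real where
  "tau = (THE t. t > 0 \<and> coth (t / 2) = t / 2)"

end

theory Submission
  imports Defs "HOL-Probability.Distributions"
begin

text \<open>
  The norm of the rank-one operator $\Pi_{a,k}$ is $\int |h_k(y+ia)|^2\,dy$. Expanding $H_k(y+ia)$
  in the polynomials $H_j(y)$ by the Hermite addition formula and using their orthogonality for the
  weight $e^{-y^2}$, this integral equals $e^{a^2} L_k(-2a^2)$ with $L_k$ the Laguerre polynomial.
  The Laguerre generating function at $r = e^{-t}$ then gives
  $\sum_k r^k \|\Pi_{a,k}\| = (1-r)^{-1} \exp(a^2 (1+r)/(1-r))$, where $(1+r)/(1-r) = \coth(t/2)$.
  So the double series is, up to a factor depending only on $t$, the Gaussian sum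
  $\sum_n \exp(b^2 n^2 (\coth(t/2) - t/2))$, which is finite exactly when $\coth(t/2) < t/2$. Since
  $\coth$ is strictly decreasing, this means $t > \tau$.
\<close>

subsection \<open>Gaussian integrals of polynomials\<close>

lemma has_bochner_integral_gauss_even:
  "has_bochner_integral lborel (\<lambda>x::real. x ^ (2 * k) * exp (- x\<^sup>2))
     (sqrt pi * fact (2 * k) / (4 ^ k * fact k))"
proof -
  \<comment> \<open>With standard deviation \<open>1 / sqrt 2\<close> the normal density is
    exp(-x^2) / sqrt pi, so the known normal moments apply after scaling.\<close>
  have "has_bochner_integral lborel (\<lambda>x. sqrt pi * (normal_density 0 (1 / sqrt 2) x * (x - 0) ^ (2 * k)))
     (sqrt pi * (fact (2 * k) / ((2 / (1 / sqrt 2)\<^sup>2) ^ k * fact k)))"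
    by (intro has_bochner_integral_mult_right normal_moment_even) auto
  then show ?thesis
    by (simp add: normal_density_def power_divide mult_ac real_sqrt_mult)
qed

lemma has_bochner_integral_gauss_odd:
  "has_bochner_integral lborel (\<lambda>x::real. x ^ (2 * k + 1) * exp (- x\<^sup>2)) 0"
proof -
  have "has_bochner_integral lborel (\<lambda>x. sqrt pi * (normal_density 0 (1 / sqrt 2) x * (x - 0) ^ (2 * k + 1)))
     (sqrt pi * 0)"
    by (intro has_bochner_integral_mult_right normal_moment_odd) auto
  then show ?thesis
    by (simp add: normal_density_def power_divide mult_ac real_sqrt_mult)
qed

definition gauss_integral :: "real poly \<Rightarrow> real" where
  "gauss_integral p = (LINT x|lborel. poly p x * exp (- x\<^sup>2))"

lemma integrable_gauss_power: "integrable lborel (\<lambda>x::real. x ^ n * exp (- x\<^sup>2))"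
proof (cases "even n")
  case True
  then obtain k where "n = 2 * k" by blast
  then show ?thesis using has_bochner_integral_gauss_even[of k] by (auto simp: has_bochner_integral_iff)
next
  case False
  then obtain k where "n = 2 * k + 1" using oddE by blast
  then show ?thesis using has_bochner_integral_gauss_odd[of k] by (simp add: has_bochner_integral_iff)
qed

lemma integrable_gauss_poly: "integrable lborel (\<lambda>x::real. poly p x * exp (- x\<^sup>2))"
  unfolding poly_altdef sum_distrib_right mult.assoc
  by (intro Bochner_Integration.integrable_sum integrable_mult_right integrable_gauss_power)

lemma gauss_integral_add: "gauss_integral (p + q) = gauss_integral p + gauss_integral q"
  by (simp add: gauss_integral_def distrib_right integrable_gauss_poly)

lemma gauss_integral_diff: "gauss_integral (p - q) = gauss_integral p - gauss_integral q"
  by (simp add: gauss_integral_def left_diff_distrib integrable_gauss_poly)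

lemma gauss_integral_smult: "gauss_integral (smult c p) = c * gauss_integral p"
  by (simp add: gauss_integral_def mult.assoc)

lemma gauss_integral_0: "gauss_integral 0 = 0"
  by (simp add: gauss_integral_def)

lemma gauss_integral_monom:
  "gauss_integral (monom c n) = c * (LINT x|lborel. x ^ n * exp (- x\<^sup>2))"
  by (simp add: gauss_integral_def poly_monom mult.assoc)

lemma gauss_integral_monom_even:
  "gauss_integral (monom c (2 * k)) = c * (sqrt pi * fact (2 * k) / (4 ^ k * fact k))"
  by (simp only: gauss_integral_monom has_bochner_integral_integral_eq[OF has_bochner_integral_gauss_even])

lemma gauss_integral_monom_odd: "odd n \<Longrightarrow> gauss_integral (monom c n) = 0"
  by (elim oddE)
     (simp only: gauss_integral_monom has_bochner_integral_integral_eq[OF has_bochner_integral_gauss_odd] mult_zero_right)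

text \<open>The integrand is minus the derivative of p(x) exp(-x^2). For monomials the explicit
  moments confirm that it integrates to zero, with no boundary terms to discuss.\<close>

lemma gauss_integral_by_parts_monom:
  "gauss_integral ([:0, 2:] * monom c n - pderiv (monom c n)) = 0"
proof -
  have "[:0, 2:] * monom c n = monom (2 * c) (Suc n)"
    by (simp add: monom_Suc smult_monom)
  moreover have "gauss_integral (monom (2 * c) (Suc n)) = gauss_integral (monom (of_nat n * c) (n - 1))"
  proof (cases "even n")
    case True
    \<comment> \<open>Both sides are odd moments, except that for n = 0 the right side has
      coefficient 0.\<close>
    then show ?thesis by (cases "n = 0") (simp_all add: gauss_integral_monom_odd gauss_integral_0)
  next
    case False
    then obtain k where k: "n = 2 * k + 1" using oddE by blast
    have "Suc n = 2 * Suc k" "n - 1 = 2 * k" using k by auto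
    then have 1: "gauss_integral (monom (2 * c) (Suc n)) = 2 * c * (sqrt pi * fact (2 * Suc k) / (4 ^ Suc k * fact (Suc k)))"
      and 2: "gauss_integral (monom (of_nat n * c) (n - 1)) = real n * c * (sqrt pi * fact (2 * k) / (4 ^ k * fact k))"
      using gauss_integral_monom_even by metis+
    have 3: "fact (2 * Suc k) = 2 * real (Suc k) * (real n * fact (2 * k))"
      "4 ^ Suc k * fact (Suc k) = 4 * real (Suc k) * (4 ^ k * fact k)"
      by (simp_all add: k algebra_simps)
    have "2 * c * (s * (2 * d * (m * A)) / (4 * d * B)) = m * c * (s * A / B)" if "d \<noteq> 0" "B \<noteq> 0" for s d m A B :: real
      using that by (simp add: field_simps)
    from this[of "real (Suc k)" "4 ^ k * fact k" "sqrt pi" "real n" "fact (2 * k)"]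
    show ?thesis unfolding 1 2 3 by simp
  qed
  ultimately show ?thesis
    by (simp add: gauss_integral_diff pderiv_monom)
qed

lemma gauss_integral_by_parts: "gauss_integral ([:0, 2:] * p - pderiv p) = 0"
proof -
  \<comment> \<open>The index set is left arbitrary so that linearity can be used by induction on
    it; \<open>{..degree p}\<close> recovers \<open>p\<close>.\<close>
  have "gauss_integral ([:0, 2:] * (\<Sum>i\<in>I. monom (coeff p i) i) - pderiv (\<Sum>i\<in>I. monom (coeff p i) i)) = 0"
    if "finite I" for I
    using that
  proof (induction I rule: finite_induct)
    case empty
    then show ?case by (simp add: gauss_integral_0)
  next
    case (insert i I)
    let ?m = "monom (coeff p i) i" and ?s = "\<Sum>i\<in>I. monom (coeff p i) i"
    have "[:0, 2:] * (?m + ?s) - pderiv (?m + ?s) = ([:0, 2:] * ?m - pderiv ?m) + ([:0, 2:] * ?s - pderiv ?s)"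
      by (simp only: pderiv_add distrib_left add_diff_add)
    moreover have "(\<Sum>i\<in>insert i I. monom (coeff p i) i) = ?m + ?s"
      using insert.hyps by simp
    ultimately show ?case
      by (simp only: gauss_integral_add gauss_integral_by_parts_monom insert.IH add_0)
  qed
  from this[of "{..degree p}"] show ?thesis
    by (simp only: poly_as_sum_of_monoms finite_atMost)
qed

subsection \<open>Hermite polynomials\<close>

text \<open>These are the physicists' Hermite polynomials. The coefficient ring is left open because
  orthogonality is used over the reals and evaluation over the complex numbers.\<close>

primrec hermite :: "nat \<Rightarrow> 'a::{idom} poly" where
  "hermite 0 = 1"
| "hermite (Suc k) = [:0, 2:] * hermite k - pderiv (hermite k)"

lemma pderiv_hermite_Suc: "pderiv (hermite (Suc k)) = smult (2 * of_nat (Suc k)) (hermite k)"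
proof (induction k)
  case 0
  then show ?case by (simp add: pderiv_pCons)
next
  case (Suc k)
  have "pderiv (hermite (Suc (Suc k)) :: 'a poly)
      = [:0, 2:] * pderiv (hermite (Suc k)) + smult 2 (hermite (Suc k)) - pderiv (pderiv (hermite (Suc k)))"
    by (subst hermite.simps(2), subst pderiv_diff, subst pderiv_mult) (simp add: pderiv_pCons)
  \<comment> \<open>The induction hypothesis rewrites both the first and the second derivative, so a
    common scalar comes out and the bracket is again \<open>hermite (Suc k)\<close>.\<close>
  also have "\<dots> = smult (2 * of_nat (Suc k)) ([:0, 2:] * hermite k - pderiv (hermite k)) + smult 2 (hermite (Suc k))"
    by (simp only: Suc pderiv_smult smult_diff_right mult_smult_right) simp
  also have "\<dots> = smult (2 * of_nat (Suc (Suc k))) (hermite (Suc k))"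
    by (simp only: hermite.simps(2)[symmetric] smult_add_left[symmetric]) (simp add: algebra_simps)
  finally show ?case .
qed

text \<open>This recurrence is free of derivatives and so survives evaluation at a point.\<close>

lemma hermite_Suc_Suc:
  "hermite (Suc (Suc k)) = [:0, 2:] * hermite (Suc k) - smult (2 * of_nat (Suc k)) (hermite k)"
  by (subst hermite.simps(2)) (simp only: pderiv_hermite_Suc)

text \<open>For the Gaussian weight the raising operator 2x - d/dx is adjoint to d/dx: integrate by
  parts with p H_k.\<close>

lemma gauss_integral_mult_hermite_Suc:
  "gauss_integral (p * hermite (Suc k)) = gauss_integral (pderiv p * hermite k)"
proof -
  have "p * hermite (Suc k) = ([:0, 2:] * (p * hermite k) - pderiv (p * hermite k)) + pderiv p * hermite k"
    by (simp only: hermite.simps(2) pderiv_mult) (simp add: algebra_simps)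
  then show ?thesis by (simp only: gauss_integral_add gauss_integral_by_parts)
qed

text \<open>Moving one raising operator across as a derivative lowers both indices by one, at the
  cost of a factor 2j. If one index reaches 0 first, the derivative of the constant 1 kills the
  integral.\<close>

lemma gauss_integral_hermite_mult:
  "gauss_integral (hermite j * hermite k) = (if j = k then 2 ^ k * fact k * sqrt pi else 0)"
proof (induction k arbitrary: j)
  case 0
  show ?case
  proof (cases j)
    case 0
    then show ?thesis using gauss_integral_monom_even[of 1 0] by (simp add: monom_0 one_pCons)
  next
    case (Suc i)
    then show ?thesis using gauss_integral_mult_hermite_Suc[of 1 i] by (simp add: gauss_integral_0)
  qed
next
  case (Suc k)
  show ?case
  proof (cases j)
    case 0
    then show ?thesis using gauss_integral_mult_hermite_Suc[of 1 k] by (simp add: gauss_integral_0)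
  next
    case (Suc i)
    have "gauss_integral (hermite (Suc i) * hermite (Suc k)) = 2 * of_nat (Suc i) * gauss_integral (hermite i * hermite k)"
      by (simp only: gauss_integral_mult_hermite_Suc pderiv_hermite_Suc mult_smult_left gauss_integral_smult)
    then show ?thesis using Suc.IH[of i] Suc by simp
  qed
qed

section \<open>The Hermite addition formula\<close>

lemma sum_binomial_Suc:
  fixes u :: "nat \<Rightarrow> 'a::comm_ring_1"
  shows "(\<Sum>j\<le>k. of_nat (k choose j) * c ^ (k - j) * (u (Suc j) + c * u j))
       = (\<Sum>j\<le>Suc k. of_nat (Suc k choose j) * c ^ (Suc k - j) * u j)"
proof -
  \<comment> \<open>The range may be extended to k + 1 because \<open>k choose Suc k\<close> is 0;
    splitting off j = 0 then prepares Pascal's rule.\<close>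
  have "(\<Sum>j\<le>k. of_nat (k choose j) * c ^ (k - j) * (c * u j))
      = (\<Sum>j\<le>Suc k. of_nat (k choose j) * c ^ (Suc k - j) * u j)"
    by (simp add: Suc_diff_le mult_ac binomial_eq_0)
  also have "\<dots> = c ^ Suc k * u 0 + (\<Sum>j\<le>k. of_nat (k choose Suc j) * c ^ (k - j) * u (Suc j))"
    by (subst sum.atMost_Suc_shift) simp
  finally have 1: "(\<Sum>j\<le>k. of_nat (k choose j) * c ^ (k - j) * (c * u j)) = \<dots>" .
  show ?thesis
    by (subst sum.atMost_Suc_shift) (simp add: distrib_left sum.distrib 1 distrib_right)
qed

lemma pderiv_sum: "pderiv (\<Sum>i\<in>A. f i) = (\<Sum>i\<in>A. pderiv (f i))"
  by (induction A rule: infinite_finite_induct) (simp_all add: pderiv_add)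

text \<open>Let R = 2x - d/dx. Shifting the argument by y turns R into R + 2y, and R commutes with
  the constant 2y, so the claim is the binomial expansion of (R + 2y)^k applied to 1, where R^j 1 =
  H_j. Keeping y fixed inside a polynomial in x makes d/dx available as
  \<open>pderiv\<close>.\<close>

lemma hermite_pcompose_shift:
  fixes y :: "'a::idom"
  shows "pcompose (hermite k) [:y, 1:] = (\<Sum>j\<le>k. of_nat (k choose j) * [:2 * y:] ^ (k - j) * hermite j)"
proof (induction k)
  case 0
  then show ?case by (simp add: pcompose_1)
next
  case (Suc k)
  let ?T = "pcompose (hermite k) [:y, 1:]"
  have T: "pcompose (hermite (Suc k)) [:y, 1:] = [:0, 2:] * ?T - pderiv ?T + [:2 * y:] * ?T"
  proof -
    have "pcompose (hermite (Suc k)) [:y, 1:] = [:2 * y, 2:] * ?T - pcompose (pderiv (hermite k)) [:y, 1:]"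
      by (simp add: pcompose_diff pcompose_mult pcompose_pCons pcompose_smult smult_add_right mult.commute)
    moreover have "pderiv ?T = pcompose (pderiv (hermite k)) [:y, 1:]"
      by (simp add: pderiv_pcompose pderiv_pCons)
    moreover have "[:2 * y, 2:] = [:0, 2:] + [:2 * y:]" by simp
    ultimately show ?thesis by (simp only: distrib_right) simp
  qed
  let ?b = "\<lambda>j. of_nat (k choose j) * [:2 * y:] ^ (k - j) :: 'a poly"
  have const: "pderiv (?b j * hermite j) = ?b j * pderiv (hermite j)" for j
  proof -
    have "?b j = [:of_nat (k choose j) * (2 * y) ^ (k - j):]"
      by (simp add: of_nat_poly poly_const_pow)
    then have "pderiv (?b j) = 0" by simp
    then show ?thesis by (simp only: pderiv_mult[of "?b j"] mult_zero_right add_0_right)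
  qed
  have "pderiv ?T = (\<Sum>j\<le>k. ?b j * pderiv (hermite j))"
    by (simp only: Suc pderiv_sum const)
  then have "pcompose (hermite (Suc k)) [:y, 1:] = (\<Sum>j\<le>k. ?b j * (hermite (Suc j) + [:2 * y:] * hermite j))"
    unfolding T Suc
    by (simp only: sum_distrib_left sum_subtractf[symmetric] sum.distrib[symmetric] hermite.simps(2))
       (intro sum.cong refl, simp only: algebra_simps)
  then show ?case by (simp only: sum_binomial_Suc)
qed

lemma poly_hermite_add:
  fixes x y :: "'a::idom"
  shows "poly (hermite k) (x + y) = (\<Sum>j\<le>k. of_nat (k choose j) * (2 * y) ^ (k - j) * poly (hermite j) x)"
proof -
  have "poly (hermite k) (x + y) = poly (pcompose (hermite k) [:y, 1:]) x"
    by (simp add: poly_pcompose add.commute)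
  also have "\<dots> = (\<Sum>j\<le>k. of_nat (k choose j) * (2 * y) ^ (k - j) * poly (hermite j) x)"
    by (simp only: hermite_pcompose_shift) (simp add: poly_sum)
  finally show ?thesis .
qed

lemma poly_hermite_of_real:
  "poly (hermite k) (of_real x :: 'a::{real_normed_algebra_1,idom}) = of_real (poly (hermite k) x)"
proof -
  \<comment> \<open>Two consecutive indices are carried along, since the recurrence looks back two
    steps.\<close>
  have "poly (hermite k) (of_real x :: 'a) = of_real (poly (hermite k) x)
      \<and> poly (hermite (Suc k)) (of_real x :: 'a) = of_real (poly (hermite (Suc k)) x)"
  proof (induction k)
    case 0
    show ?case by simp
  next
    case (Suc k)
    then show ?case by (simp add: hermite_Suc_Suc del: hermite.simps)
  qed
  then show ?thesis ..
qed

text \<open>Applied to p(z) exp(-z^2/2), the operator z - d/dz acts on the factor p as 2z - d/dz,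
  which is the recursion of \<open>hermite\<close>.\<close>

lemma hermite_fun_eq:
  "hermite_fun k z = poly (hermite k) z * exp (- z\<^sup>2 / 2) / of_real (sqrt (2 ^ k * fact k * sqrt pi))"
proof -
  have "((\<lambda>f z. z * f z - deriv f z) ^^ k) (\<lambda>z. exp (- z\<^sup>2 / 2)) = (\<lambda>z::complex. poly (hermite k) z * exp (- z\<^sup>2 / 2))"
  proof (induction k)
    case 0
    then show ?case by simp
  next
    case (Suc k)
    have "deriv (\<lambda>z::complex. poly (hermite k) z * exp (- z\<^sup>2 / 2)) z
        = poly (pderiv (hermite k)) z * exp (- z\<^sup>2 / 2) - z * (poly (hermite k) z * exp (- z\<^sup>2 / 2))" for z
      by (rule DERIV_imp_deriv) (auto intro!: derivative_eq_intros poly_DERIV simp: algebra_simps)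
    then show ?case
      by (simp only: funpow.simps o_apply Suc) (simp add: fun_eq_iff algebra_simps)
  qed
  then show ?thesis by (simp add: hermite_fun_def)
qed

section \<open>Norms of the shifted Hermite functions\<close>

lemma gauss_integral_sum: "gauss_integral (\<Sum>i\<in>A. f i) = (\<Sum>i\<in>A. gauss_integral (f i))"
  by (induction A rule: infinite_finite_induct) (simp_all add: gauss_integral_add gauss_integral_0)

text \<open>This makes |H_k(x + ia)|^2 a real polynomial in x, to which
  \<open>gauss_integral\<close> applies. Real parts suffice because the left side is real.\<close>

lemma cmod_sum_real_combination_squared:
  fixes c :: "'a \<Rightarrow> complex" and h :: "'a \<Rightarrow> real"
  shows "(cmod (\<Sum>j\<in>A. c j * of_real (h j)))\<^sup>2 = (\<Sum>j\<in>A. \<Sum>l\<in>A. Re (c j * cnj (c l)) * (h j * h l))"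
proof -
  have "complex_of_real ((cmod (\<Sum>j\<in>A. c j * of_real (h j)))\<^sup>2)
      = (\<Sum>j\<in>A. c j * of_real (h j)) * (\<Sum>l\<in>A. cnj (c l) * of_real (h l))"
    by (simp only: complex_norm_square cnj_sum complex_cnj_mult complex_cnj_complex_of_real)
  also have "\<dots> = (\<Sum>j\<in>A. \<Sum>l\<in>A. (c j * cnj (c l)) * of_real (h j * h l))"
    by (simp add: sum_product mult_ac)
  finally have "Re (complex_of_real ((cmod (\<Sum>j\<in>A. c j * of_real (h j)))\<^sup>2)) = Re \<dots>"
    by (rule arg_cong)
  moreover have "Re (z * of_real r) = Re z * r" for z r
    by simp
  ultimately show ?thesis
    by (simp only: Re_complex_of_real Re_sum)
qed

text \<open>The Laguerre polynomial evaluated at the negated argument, $L_k(-x)$.\<close>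

definition laguerre_neg :: "nat \<Rightarrow> real \<Rightarrow> real" where
  "laguerre_neg k x = (\<Sum>m\<le>k. of_nat (k choose m) * x ^ m / fact m)"

lemma laguerre_neg_nonneg: "x \<ge> 0 \<Longrightarrow> laguerre_neg k x \<ge> 0"
  unfolding laguerre_neg_def by (intro sum_nonneg) simp

lemma has_bochner_integral_hermite_fun_shift:
  "has_bochner_integral lborel (\<lambda>x. (cmod (hermite_fun k (of_real x + \<i> * of_real a)))\<^sup>2)
     (exp (a\<^sup>2) * laguerre_neg k (2 * a\<^sup>2))"
proof -
  define N where "N = 2 ^ k * fact k * sqrt pi"
  have N: "N > 0" by (simp add: N_def)
  \<comment> \<open>\<open>c j\<close> is the coefficient of H_j(x) in the addition formula at y =
    ia, and \<open>p\<close> below is |H_k(x + ia)|^2 as a polynomial in x.\<close>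
  define c :: "nat \<Rightarrow> complex" where "c j = of_nat (k choose j) * (2 * (\<i> * of_real a)) ^ (k - j)" for j
  define p :: "real poly" where
    "p = (\<Sum>j\<le>k. \<Sum>l\<le>k. smult (Re (c j * cnj (c l))) (hermite j * hermite l))"
  have eq: "(cmod (hermite_fun k (of_real x + \<i> * of_real a)))\<^sup>2 = exp (a\<^sup>2) / N * (poly p x * exp (- x\<^sup>2))" for x
  proof -
    have "(cmod (poly (hermite k) (of_real x + \<i> * of_real a)))\<^sup>2 = poly p x"
      by (simp only: poly_hermite_add poly_hermite_of_real cmod_sum_real_combination_squared
          c_def[symmetric] p_def poly_sum poly_smult poly_mult)
    moreover have "(cmod (exp (- (of_real x + \<i> * of_real a)\<^sup>2 / 2)))\<^sup>2 = exp (a\<^sup>2) * exp (- x\<^sup>2)"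
      by (simp add: power2_eq_square exp_add[symmetric] algebra_simps)
    moreover have "(cmod (complex_of_real (sqrt (2 ^ k * fact k * sqrt pi))))\<^sup>2 = N"
      using N by (simp add: N_def)
    ultimately show ?thesis
      by (simp only: hermite_fun_eq norm_divide norm_mult power_divide power_mult_distrib) simp
  qed
  have "gauss_integral p = (\<Sum>j\<le>k. \<Sum>l\<le>k. Re (c j * cnj (c l)) * (if j = l then 2 ^ l * fact l * sqrt pi else 0))"
    by (simp only: p_def gauss_integral_sum gauss_integral_smult gauss_integral_hermite_mult)
  also have "\<dots> = (\<Sum>j\<le>k. Re (c j * cnj (c j)) * (2 ^ j * fact j * sqrt pi))"
    by (intro sum.cong refl) (simp add: if_distrib[of "\<lambda>x. _ * x"] cong: if_cong del: times_complex.sel)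
  \<comment> \<open>Only the diagonal survives orthogonality. Each term is written in k - j so that
    reversing the sum gives the Laguerre polynomial.\<close>
  also have "\<dots> = (\<Sum>j\<le>k. N * (of_nat (k choose (k - j)) * (2 * a\<^sup>2) ^ (k - j) / fact (k - j)))"
  proof (intro sum.cong refl)
    fix j assume "j \<in> {..k}"
    then have j: "j \<le> k" by simp
    then have kj: "fact k = fact j * fact (k - j) * real (k choose j)"
      by (metis binomial_fact_lemma of_nat_fact of_nat_mult)
    have "Re (c j * cnj (c j)) = (cmod (c j))\<^sup>2"
      by (simp only: complex_norm_square[symmetric] Re_complex_of_real)
    also have "\<dots> = (real (k choose j) * (2 * \<bar>a\<bar>) ^ (k - j))\<^sup>2"
      by (simp add: c_def norm_mult norm_power)
    also have "\<dots> = (real (k choose j))\<^sup>2 * (4 * a\<^sup>2) ^ (k - j)"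
    proof -
      have "((2 * \<bar>a\<bar>) ^ (k - j))\<^sup>2 = ((2 * \<bar>a\<bar>)\<^sup>2) ^ (k - j)"
        by (simp only: power_mult[symmetric] mult.commute)
      then show ?thesis by (simp only: power_mult_distrib power2_abs) simp
    qed
    \<comment> \<open>One factor 2^(k-j) joins 2^j to form the 2^k of \<open>N\<close>; one of the
      two binomials, with j!, supplies k!/(k-j)!.\<close>
    also have "(4 * a\<^sup>2) ^ (k - j) = 2 ^ (k - j) * (2 * a\<^sup>2) ^ (k - j)"
      by (simp only: power_mult_distrib[symmetric]) simp
    finally have "Re (c j * cnj (c j)) * (2 ^ j * fact j * sqrt pi)
        = (real (k choose j))\<^sup>2 * (2 * a\<^sup>2) ^ (k - j) * (2 ^ (k - j) * 2 ^ j) * fact j * sqrt pi"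
      by (simp only: mult_ac)
    also have "2 ^ (k - j) * 2 ^ j = (2 ^ k :: real)"
      using j by (simp add: power_add[symmetric])
    also have "(real (k choose j))\<^sup>2 * (2 * a\<^sup>2) ^ (k - j) * 2 ^ k * fact j * sqrt pi
        = N * (of_nat (k choose (k - j)) * (2 * a\<^sup>2) ^ (k - j) / fact (k - j))"
      unfolding N_def kj binomial_symmetric[OF j, symmetric] by (simp add: power2_eq_square)
    finally show "Re (c j * cnj (c j)) * (2 ^ j * fact j * sqrt pi)
      = N * (of_nat (k choose (k - j)) * (2 * a\<^sup>2) ^ (k - j) / fact (k - j))" .
  qed
  also have "\<dots> = N * laguerre_neg k (2 * a\<^sup>2)"
    unfolding laguerre_neg_def sum_distrib_left
    using sum.nat_diff_reindex[of "\<lambda>m. N * (of_nat (k choose m) * (2 * a\<^sup>2) ^ m / fact m)" "Suc k"]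
    by (simp add: lessThan_Suc_atMost)
  finally have "gauss_integral p = N * laguerre_neg k (2 * a\<^sup>2)" .
  then have "has_bochner_integral lborel (\<lambda>x. poly p x * exp (- x\<^sup>2)) (N * laguerre_neg k (2 * a\<^sup>2))"
    by (simp add: has_bochner_integral_iff integrable_gauss_poly gauss_integral_def)
  from has_bochner_integral_mult_right[OF this, of "exp (a\<^sup>2) / N"]
  show ?thesis using N by (simp add: eq)
qed

subsection \<open>Norms of the spectral projections\<close>

text \<open>Cauchy-Schwarz, by integrating 2uv <= s u^2 + v^2/s and then choosing the weight
  s.\<close>

lemma cmod_L2_inner_le:
  assumes f: "square_integrable f" and g: "square_integrable g"
  shows "cmod (L2_inner f g) \<le> sqrt (LINT x|lborel. (cmod (f x))\<^sup>2) * sqrt (LINT x|lborel. (cmod (g x))\<^sup>2)"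
proof -
  define F where "F = sqrt (LINT x|lborel. (cmod (f x))\<^sup>2)"
  define G where "G = sqrt (LINT x|lborel. (cmod (g x))\<^sup>2)"
  have FG: "F \<ge> 0" "G \<ge> 0" "(LINT x|lborel. (cmod (f x))\<^sup>2) = F\<^sup>2" "(LINT x|lborel. (cmod (g x))\<^sup>2) = G\<^sup>2"
    by (simp_all add: F_def G_def)
  have int: "integrable lborel (\<lambda>x. (cmod (f x))\<^sup>2)" "integrable lborel (\<lambda>x. (cmod (g x))\<^sup>2)"
    using f g by (simp_all add: square_integrable_def)
  txt \<open>The weight \<open>s\<close> is chosen close to $G/F$, perturbed so that it stays positive and finite.\<close>
  have amgm: "cmod (L2_inner f g) \<le> (s * F\<^sup>2 + G\<^sup>2 / s) / 2" if s: "s > 0" for s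
  proof -
    have "cmod (L2_inner f g) \<le> (LINT x|lborel. cmod (f x * cnj (g x)))"
      unfolding L2_inner_def by (rule integral_norm_bound)
    also have "\<dots> \<le> (LINT x|lborel. (s * (cmod (f x))\<^sup>2 + (cmod (g x))\<^sup>2 / s) / 2)"
    proof (rule integral_mono')
      show "integrable lborel (\<lambda>x. (s * (cmod (f x))\<^sup>2 + (cmod (g x))\<^sup>2 / s) / 2)"
        using int by simp
      fix x
      show "0 \<le> (s * (cmod (f x))\<^sup>2 + (cmod (g x))\<^sup>2 / s) / 2" using s by simp
      have "0 \<le> (s * cmod (f x) - cmod (g x))\<^sup>2 / s" using s by simp
      also have "\<dots> = s * (cmod (f x))\<^sup>2 + (cmod (g x))\<^sup>2 / s - 2 * (cmod (f x) * cmod (g x))"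
        using s by (simp add: field_simps power2_eq_square)
      finally show "cmod (f x * cnj (g x)) \<le> (s * (cmod (f x))\<^sup>2 + (cmod (g x))\<^sup>2 / s) / 2"
        by (simp add: norm_mult)
    qed
    also have "\<dots> = (s * F\<^sup>2 + G\<^sup>2 / s) / 2"
      using int by (simp add: FG(3,4))
    finally show ?thesis .
  qed
  have "cmod (L2_inner f g) \<le> F * G"
  proof (rule field_le_epsilon)
    fix e :: real assume "e > 0"
    \<comment> \<open>The two summands of \<open>amgm\<close> will be at most (G + d) F and G (F +
      d), so their mean exceeds F G by d (F + G) / 2. The 1 in the denominator covers F = G =
      0.\<close>
    define d where "d = e / (F + G + 1)"
    define s where "s = (G + d) / (F + d)"
    have d: "d > 0" "d * (F + G) \<le> e"
      using \<open>e > 0\<close> FG(1,2) by (simp_all add: d_def field_simps)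
    have s: "s > 0" using d FG(1,2) by (simp add: s_def)
    have "s * F\<^sup>2 = (G + d) * F * (F / (F + d))"
      by (simp add: s_def power2_eq_square)
    also have "\<dots> \<le> (G + d) * F"
      using d FG(1,2) by (intro mult_left_le) simp_all
    finally have 1: "s * F\<^sup>2 \<le> (G + d) * F" .
    have "G\<^sup>2 / s = G * (F + d) * (G / (G + d))"
      by (simp add: s_def power2_eq_square)
    also have "\<dots> \<le> G * (F + d)"
      using d FG(1,2) by (intro mult_left_le) simp_all
    finally have 2: "G\<^sup>2 / s \<le> G * (F + d)" .
    have "0 \<le> d * (F + G)" using d FG(1,2) by simp
    with amgm[OF s] 1 2 d(2) show "cmod (L2_inner f g) \<le> F * G + e"
      by (simp add: algebra_simps)
  qed
  then show ?thesis by (simp add: F_def G_def)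
qed

text \<open>Cauchy-Schwarz bounds the norm from above, and g divided by its norm attains the
  bound.\<close>

lemma L2_opnorm_rank_one:
  assumes g: "square_integrable g" and h: "square_integrable h"
  shows "L2_opnorm (\<lambda>f y. L2_inner f g * h y) = L2_norm g * L2_norm h"
proof -
  define G where "G = sqrt (LINT x|lborel. (cmod (g x))\<^sup>2)"
  define H where "H = sqrt (LINT x|lborel. (cmod (h x))\<^sup>2)"
  have GH: "G \<ge> 0" "H \<ge> 0" "(LINT x|lborel. (cmod (g x))\<^sup>2) = G\<^sup>2"
    by (simp_all add: G_def H_def)
  have norms: "L2_norm g = ennreal G" "L2_norm h = ennreal H"
    using g h by (simp_all add: L2_norm_def G_def H_def)
  have norm_scaled: "L2_norm (\<lambda>y. c * h y) = ennreal (cmod c * H)" for c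
  proof -
    have "square_integrable (\<lambda>y. c * h y)"
      using h by (auto simp: square_integrable_def norm_mult power_mult_distrib)
    then show ?thesis
      by (simp add: L2_norm_def norm_mult power_mult_distrib real_sqrt_mult H_def)
  qed
  have "L2_opnorm (\<lambda>f y. L2_inner f g * h y) \<le> ennreal (G * H)"
    unfolding L2_opnorm_def norm_scaled
  proof (rule SUP_least)
    fix f assume "f \<in> {f. square_integrable f \<and> L2_norm f \<le> 1}"
    then have f: "square_integrable f" and "sqrt (LINT x|lborel. (cmod (f x))\<^sup>2) \<le> 1"
      by (auto simp: L2_norm_def ennreal_le_1)
    then have "cmod (L2_inner f g) \<le> 1 * G"
      using cmod_L2_inner_le[OF f g] GH(1) unfolding G_def[symmetric]
      by (meson mult_right_mono order_trans)
    then show "ennreal (cmod (L2_inner f g) * H) \<le> ennreal (G * H)"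
      using GH by (intro ennreal_leI mult_right_mono) auto
  qed
  moreover have "ennreal (G * H) \<le> L2_opnorm (\<lambda>f y. L2_inner f g * h y)"
  proof (cases "G = 0")
    case False
    then have G: "G > 0" using GH by simp
    define f where "f = (\<lambda>x. of_real (1 / G) * g x)"
    have f: "square_integrable f"
      using g by (auto simp: square_integrable_def f_def norm_mult norm_divide power_divide)
    have "(LINT x|lborel. (cmod (f x))\<^sup>2) = (1 / G\<^sup>2) * (LINT x|lborel. (cmod (g x))\<^sup>2)"
      by (simp add: f_def norm_mult norm_divide power_divide)
    then have nf: "L2_norm f \<le> 1"
      using f G by (simp add: L2_norm_def GH)
    have "L2_inner f g = of_real (1 / G) * (LINT x|lborel. complex_of_real ((cmod (g x))\<^sup>2))"
      unfolding L2_inner_def f_def complex_norm_square by (simp add: mult.assoc)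
    also have "\<dots> = of_real G"
      by (simp only: integral_complex_of_real GH) (use G in \<open>simp add: power2_eq_square\<close>)
    finally have "L2_norm (\<lambda>y. L2_inner f g * h y) = ennreal (G * H)"
      using G by (simp add: norm_scaled)
    then show ?thesis
      unfolding L2_opnorm_def using f nf
      by (metis (mono_tags, lifting) SUP_upper mem_Collect_eq)
  qed simp
  ultimately show ?thesis
    using GH by (simp add: norms ennreal_mult antisym)
qed

lemma square_integrable_hermite_fun_shift:
  "square_integrable (\<lambda>x. hermite_fun k (of_real x + \<i> * of_real a))"
proof -
  have "continuous_on UNIV (\<lambda>x::real. hermite_fun k (of_real x + \<i> * of_real a))"
    unfolding hermite_fun_eq by (intro continuous_intros) auto
  then show ?thesis
    using has_bochner_integral_hermite_fun_shift[of k a]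
    by (auto simp: square_integrable_def has_bochner_integral_iff intro: borel_measurable_continuous_onI)
qed

lemma L2_norm_hermite_fun_shift:
  "L2_norm (\<lambda>x. hermite_fun k (of_real x + \<i> * of_real a)) = ennreal (sqrt (exp (a\<^sup>2) * laguerre_neg k (2 * a\<^sup>2)))"
  using has_bochner_integral_hermite_fun_shift[of k a] square_integrable_hermite_fun_shift[of k a]
  by (simp add: L2_norm_def has_bochner_integral_iff)

text \<open>The two functions of the rank-one operator are shifted by a and -a. Their norms depend
  only on a^2, so the product of the two equal square roots is the squared norm.\<close>

lemma L2_opnorm_spectral_proj:
  "L2_opnorm (spectral_proj a k) = ennreal (exp (a\<^sup>2) * laguerre_neg k (2 * a\<^sup>2))"
proof -
  have "L2_opnorm (spectral_proj a k)
      = L2_norm (\<lambda>x. hermite_fun k (of_real x + \<i> * of_real a)) * L2_norm (\<lambda>x. hermite_fun k (of_real x + \<i> * of_real (- a)))"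
    using L2_opnorm_rank_one[OF square_integrable_hermite_fun_shift[of k a] square_integrable_hermite_fun_shift[of k "- a"]]
    by (simp add: spectral_proj_def[abs_def])
  also have "\<dots> = ennreal (exp (a\<^sup>2) * laguerre_neg k (2 * a\<^sup>2))"
    unfolding L2_norm_hermite_fun_shift
    by (simp add: ennreal_mult[symmetric] laguerre_neg_nonneg)
  finally show ?thesis .
qed

subsection \<open>Convergence of the double series\<close>

lemma binomial_power_sums:
  fixes r :: real
  assumes "\<bar>r\<bar> < 1"
  shows "(\<lambda>n. of_nat (n choose m) * r ^ n) sums (r ^ m / (1 - r) ^ (m + 1))"
proof -
  \<comment> \<open>Newton's binomial series with exponent -(m+1), later shifted by m; the first m
    terms of the target series vanish.\<close>
  have "(\<lambda>n. ((- real (m + 1)) gchoose n) * (- r) ^ n) sums (1 + (- r)) powr (- real (m + 1))"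
    using assms by (intro gen_binomial_real) auto
  also have "(\<lambda>n. ((- real (m + 1)) gchoose n) * (- r) ^ n) = (\<lambda>n. of_nat ((n + m) choose m) * r ^ n)"
  proof
    fix n
    have "(- real (m + 1)) gchoose n = (- 1) ^ n * (real (n + m) gchoose n)"
      by (subst gbinomial_minus) (simp add: add.commute)
    also have "real (n + m) gchoose n = of_nat ((n + m) choose m)"
      by (metis binomial_gbinomial binomial_symmetric add_diff_cancel_left' le_add1)
    finally show "((- real (m + 1)) gchoose n) * (- r) ^ n = of_nat ((n + m) choose m) * r ^ n"
      by (simp add: power_minus[of r])
  qed
  also have "(1 + (- r)) powr (- real (m + 1)) = 1 / (1 - r) ^ (m + 1)"
    using assms by (simp only: powr_minus powr_realpow) (simp add: powr_minus powr_realpow field_simps flip: power_Suc)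
  finally have "(\<lambda>n. r ^ m * (of_nat ((n + m) choose m) * r ^ n)) sums (r ^ m * (1 / (1 - r) ^ (m + 1)))"
    by (rule sums_mult)
  then have "(\<lambda>n. of_nat ((n + m) choose m) * r ^ (n + m)) sums (r ^ m / (1 - r) ^ (m + 1))"
    by (simp add: power_add mult_ac)
  then show ?thesis
    by (subst (asm) sums_iff_shift) (simp add: binomial_eq_0)
qed

text \<open>The double series over m and k is nonnegative, so the order of summation may be
  exchanged. Summing over k first leaves the exponential series at x r / (1 - r); summing over m
  first gives the Laguerre values.\<close>

lemma laguerre_neg_has_sum:
  assumes r: "0 \<le> r" "r < 1" and x: "0 \<le> x"
  shows "((\<lambda>k. r ^ k * laguerre_neg k x) has_sum (exp (x * r / (1 - r)) / (1 - r))) UNIV"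
proof -
  define f where "f = (\<lambda>(m, k). x ^ m / fact m * (of_nat (k choose m) * r ^ k))"
  have f_nonneg: "f p \<ge> 0" for p
    using r x by (auto simp: f_def split: prod.split)
  have inner: "((\<lambda>k. f (m, k)) has_sum (x ^ m / fact m * (r ^ m / (1 - r) ^ (m + 1)))) UNIV" for m
    unfolding f_def prod.case
    using r by (intro has_sum_cmult_right sums_nonneg_imp_has_sum binomial_power_sums) auto
  have "(\<lambda>m. (x * r / (1 - r)) ^ m /\<^sub>R fact m) sums exp (x * r / (1 - r))"
    by (rule exp_converges)
  then have "(\<lambda>m. (x * r / (1 - r)) ^ m /\<^sub>R fact m / (1 - r)) sums (exp (x * r / (1 - r)) / (1 - r))"
    by (rule sums_divide)
  also have "(\<lambda>m. (x * r / (1 - r)) ^ m /\<^sub>R fact m / (1 - r)) = (\<lambda>m. x ^ m / fact m * (r ^ m / (1 - r) ^ (m + 1)))"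
    by (auto simp: fun_eq_iff power_mult_distrib power_divide field_simps)
  finally have outer: "((\<lambda>m. x ^ m / fact m * (r ^ m / (1 - r) ^ (m + 1))) has_sum (exp (x * r / (1 - r)) / (1 - r))) UNIV"
    using r x by (intro sums_nonneg_imp_has_sum) auto
  have "(f has_sum (exp (x * r / (1 - r)) / (1 - r))) (UNIV \<times> UNIV)"
  proof (rule has_sum_SigmaI[OF inner outer])
    show "f summable_on UNIV \<times> UNIV"
      using inner outer f_nonneg by (intro summable_on_SigmaI[where g = "\<lambda>m. x ^ m / fact m * (r ^ m / (1 - r) ^ (m + 1))"])
        (auto simp: has_sum_imp_summable)
  qed
  then have "((\<lambda>(k, m). f (m, k)) has_sum (exp (x * r / (1 - r)) / (1 - r))) (UNIV \<times> UNIV)"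
    by (subst (asm) has_sum_swap)
  then show ?thesis
  proof (rule has_sum_SigmaD)
    fix k :: nat
    show "((\<lambda>m. case (k, m) of (k, m) \<Rightarrow> f (m, k)) has_sum (r ^ k * laguerre_neg k x)) UNIV"
      by (rule has_sum_finite_neutralI[where B = "{..k}"])
         (auto simp: f_def laguerre_neg_def sum_distrib_left binomial_eq_0 mult_ac)
  qed
qed

lemma infsum_ennreal_eq:
  assumes "(f has_sum s) A" and "\<And>x. x \<in> A \<Longrightarrow> f x \<ge> 0"
  shows "(\<Sum>\<^sub>\<infinity>x\<in>A. ennreal (f x)) = ennreal s"
proof -
  have "((\<lambda>F. ennreal (sum f F)) \<longlongrightarrow> ennreal s) (finite_subsets_at_top A)"
    using assms(1) unfolding has_sum_def by (rule tendsto_ennrealI)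
  \<comment> \<open>Nonnegativity matters here: \<open>ennreal\<close> sends negative reals to 0 and
    is additive only on nonnegative ones.\<close>
  moreover have "\<forall>\<^sub>F F in finite_subsets_at_top A. ennreal (sum f F) = (\<Sum>x\<in>F. ennreal (f x))"
    by (rule eventually_finite_subsets_at_top_weakI) (use assms(2) in \<open>auto simp: subset_iff\<close>)
  ultimately have "((\<lambda>x. ennreal (f x)) has_sum ennreal s) A"
    unfolding has_sum_def by (rule Lim_transform_eventually)
  then show ?thesis by (rule infsumI)
qed

lemma coth_half:
  assumes "t > 0"
  shows "coth (t / 2) = (1 + exp (- t)) / (1 - exp (- t))"
proof -
  define u where "u = exp (t / 2)"
  have u: "u > 1" using assms by (simp add: u_def)
  have "exp (- t) = 1 / u\<^sup>2"
    by (simp add: u_def power2_eq_square exp_add[symmetric] exp_minus field_simps)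
  then have "cosh (t / 2) = u / 2 * (1 + exp (- t))" "sinh (t / 2) = u / 2 * (1 - exp (- t))"
    using u by (simp_all add: cosh_field_def sinh_field_def u_def[symmetric] exp_minus field_simps power2_eq_square)
  then show ?thesis
    using u by (simp only: coth_def) simp
qed

lemma infsum_opnorm_spectral_proj:
  assumes t: "t > 0"
  shows "(\<Sum>\<^sub>\<infinity>k::nat. ennreal (exp (- t * (a\<^sup>2 / 2 + of_nat k))) * L2_opnorm (spectral_proj a k))
       = ennreal (exp (a\<^sup>2 * (coth (t / 2) - t / 2)) / (1 - exp (- t)))"
proof -
  define r where "r = exp (- t)"
  have r: "0 \<le> r" "r < 1" using t by (simp_all add: r_def)
  have "((\<lambda>k. exp (a\<^sup>2 - t * a\<^sup>2 / 2) * (r ^ k * laguerre_neg k (2 * a\<^sup>2)))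
      has_sum (exp (a\<^sup>2 - t * a\<^sup>2 / 2) * (exp (2 * a\<^sup>2 * r / (1 - r)) / (1 - r)))) UNIV"
    by (intro has_sum_cmult_right laguerre_neg_has_sum r) simp
  also have "exp (a\<^sup>2 - t * a\<^sup>2 / 2) * (exp (2 * a\<^sup>2 * r / (1 - r)) / (1 - r))
      = exp (a\<^sup>2 * (coth (t / 2) - t / 2)) / (1 - r)"
  proof -
    \<comment> \<open>This rests on 1 + 2r/(1-r) = (1+r)/(1-r), which is coth(t/2) at r =
      exp(-t).\<close>
    have "a\<^sup>2 - t * a\<^sup>2 / 2 + 2 * a\<^sup>2 * r / (1 - r) = a\<^sup>2 * ((1 + r) / (1 - r) - t / 2)"
      using r by (simp add: field_simps)
    then show ?thesis
      by (simp add: coth_half[OF t] r_def[symmetric] exp_add[symmetric])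
  qed
  finally have "(\<Sum>\<^sub>\<infinity>k. ennreal (exp (a\<^sup>2 - t * a\<^sup>2 / 2) * (r ^ k * laguerre_neg k (2 * a\<^sup>2))))
      = ennreal (exp (a\<^sup>2 * (coth (t / 2) - t / 2)) / (1 - r))"
    using r by (intro infsum_ennreal_eq) (auto simp: laguerre_neg_nonneg)
  moreover have "ennreal (exp (- t * (a\<^sup>2 / 2 + of_nat k))) * L2_opnorm (spectral_proj a k)
      = ennreal (exp (a\<^sup>2 - t * a\<^sup>2 / 2) * (r ^ k * laguerre_neg k (2 * a\<^sup>2)))" for k
  proof -
    have "exp (- t * (a\<^sup>2 / 2 + of_nat k)) * exp (a\<^sup>2) = exp (a\<^sup>2 - t * a\<^sup>2 / 2) * r ^ k"
      by (simp add: r_def exp_of_nat_mult[symmetric] exp_add[symmetric] algebra_simps)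
    then have "exp (- t * (a\<^sup>2 / 2 + of_nat k)) * (exp (a\<^sup>2) * laguerre_neg k (2 * a\<^sup>2))
        = exp (a\<^sup>2 - t * a\<^sup>2 / 2) * (r ^ k * laguerre_neg k (2 * a\<^sup>2))"
      by (metis mult.assoc)
    then show ?thesis
      by (simp only: L2_opnorm_spectral_proj ennreal_mult[symmetric] exp_ge_zero mult_nonneg_nonneg
          laguerre_neg_nonneg zero_le_power2 zero_le_numeral)
  qed
  ultimately show ?thesis by (simp add: r_def)
qed

section \<open>Gaussian sums over the integers\<close>

lemma summable_on_int_geometric:
  fixes q :: real
  assumes "0 \<le> q" "q < 1"
  shows "(\<lambda>n::int. q ^ nat \<bar>n\<bar>) summable_on UNIV"
proof -
  have geo: "(\<lambda>n::nat. q ^ n) summable_on UNIV"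
    using assms by (intro summable_nonneg_imp_summable_on summable_geometric) auto
  have "(\<lambda>n::int. q ^ nat \<bar>n\<bar>) summable_on range int"
    using geo by (subst summable_on_reindex) (auto simp: o_def inj_on_def)
  moreover have "(\<lambda>n::int. q ^ nat \<bar>n\<bar>) summable_on range (\<lambda>n. - int n)"
    using geo by (subst summable_on_reindex) (auto simp: o_def inj_on_def)
  ultimately have "(\<lambda>n::int. q ^ nat \<bar>n\<bar>) summable_on range int \<union> range (\<lambda>n. - int n)"
    by (rule summable_on_union)
  also have "range int \<union> range (\<lambda>n. - int n) = UNIV"
    by (auto simp: image_iff) (metis int_cases2)
  finally show ?thesis .
qed

text \<open>For s < 0 the bound |n| <= n^2 gives a geometric majorant of ratio exp(b^2 s), which is
  below 1 as b is nonzero. For s >= 0 infinitely many terms are at least 1/c.\<close>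

lemma infsum_gaussian_int_finite_iff:
  fixes b c s :: real
  assumes "b \<noteq> 0" "c > 0"
  shows "(\<Sum>\<^sub>\<infinity>n::int. ennreal (exp ((b * of_int n)\<^sup>2 * s) / c)) < \<infinity> \<longleftrightarrow> s < 0"
proof
  assume s: "s < 0"
  define q where "q = exp (b\<^sup>2 * s)"
  have q: "0 \<le> q" "q < 1" using s assms by (auto simp: q_def mult_less_0_iff)
  have le: "exp ((b * of_int n)\<^sup>2 * s) / c \<le> q ^ nat \<bar>n\<bar> * (1 / c)" for n :: int
  proof -
    have "nat \<bar>n\<bar> \<le> (nat \<bar>n\<bar>)\<^sup>2" by (simp only: power2_eq_square le_square)
    then have "q ^ (nat \<bar>n\<bar>)\<^sup>2 \<le> q ^ nat \<bar>n\<bar>" using q by (intro power_decreasing) auto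
    moreover have "exp ((b * of_int n)\<^sup>2 * s) = q ^ (nat \<bar>n\<bar>)\<^sup>2"
      by (simp add: q_def exp_of_nat_mult[symmetric] power_mult_distrib mult_ac)
    ultimately show ?thesis using assms by (simp add: divide_right_mono)
  qed
  have "(\<lambda>n::int. q ^ nat \<bar>n\<bar> * (1 / c)) summable_on UNIV"
    by (intro summable_on_cmult_left summable_on_int_geometric q)
  then have "(\<lambda>n::int. exp ((b * of_int n)\<^sup>2 * s) / c) summable_on UNIV"
    by (rule summable_on_comparison_test) (use le assms in auto)
  then have "(\<Sum>\<^sub>\<infinity>n::int. ennreal (exp ((b * of_int n)\<^sup>2 * s) / c))
      = ennreal (\<Sum>\<^sub>\<infinity>n::int. exp ((b * of_int n)\<^sup>2 * s) / c)"
    using assms by (intro infsum_ennreal_eq has_sum_infsum) auto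
  then show "(\<Sum>\<^sub>\<infinity>n::int. ennreal (exp ((b * of_int n)\<^sup>2 * s) / c)) < \<infinity>"
    by simp
next
  assume fin: "(\<Sum>\<^sub>\<infinity>n::int. ennreal (exp ((b * of_int n)\<^sup>2 * s) / c)) < \<infinity>"
  show "s < 0"
  proof (rule ccontr)
    assume "\<not> s < 0"
    then have "ennreal (1 / c) \<le> ennreal (exp ((b * of_int n)\<^sup>2 * s) / c)" for n :: int
      using assms by (intro ennreal_leI divide_right_mono) auto
    then have "(\<Sum>\<^sub>\<infinity>n::int. ennreal (exp ((b * of_int n)\<^sup>2 * s) / c)) = \<infinity>"
      using assms by (intro infsum_superconst_infinite_ennreal[where b = "ennreal (1 / c)"]) (auto simp: infinite_UNIV_int)
    with fin show False by simp
  qed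
qed

section \<open>The equation coth(t/2) = t/2 and its root\<close>

lemma coth_half_strict_antimono:
  assumes "0 < s" "s < t"
  shows "coth (t / 2) < coth (s / 2)"
proof -
  have "exp (- t) < exp (- s)" "exp (- s) < 1" using assms by auto
  then show ?thesis
    using assms by (simp add: coth_half field_simps)
qed

lemma ex1_tau: "\<exists>!t::real. t > 0 \<and> coth (t / 2) = t / 2"
proof (rule ex_ex1I)
  let ?g = "\<lambda>t::real. (1 + exp (- t)) / (1 - exp (- t)) - t / 2"
  \<comment> \<open>At t = 4 the sign condition amounts to exp 4 >= 3; at t = 2 it is coth 1 >= 1.
    Hence a root lies in [2, 4].\<close>
  have "exp (4::real) \<ge> 5" using exp_ge_add_one_self[of "4::real"] by simp
  then have "?g 4 \<le> 0" by (simp add: exp_minus field_simps)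
  moreover have "0 \<le> ?g 2" by (simp add: field_simps)
  moreover have "continuous_on {2..4} ?g" by (intro continuous_intros) auto
  ultimately obtain t where "2 \<le> t" "t \<le> 4" "?g t = 0"
    using IVT2'[of ?g 4 0 2] by auto
  then show "\<exists>t::real. t > 0 \<and> coth (t / 2) = t / 2"
    by (intro exI[of _ t]) (simp add: coth_half)
next
  fix s t :: real
  assume "s > 0 \<and> coth (s / 2) = s / 2" "t > 0 \<and> coth (t / 2) = t / 2"
  then show "s = t"
    \<comment> \<open>A strictly decreasing and a strictly increasing function agree at most
      once.\<close>
    using coth_half_strict_antimono[of s t] coth_half_strict_antimono[of t s] by linarith
qed

lemma coth_half_less_iff:
  assumes "t > 0"
  shows "coth (t / 2) < t / 2 \<longleftrightarrow> tau < t"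
proof -
  have "tau > 0" "coth (tau / 2) = tau / 2"
    using theI'[OF ex1_tau] unfolding tau_def by auto
  then show ?thesis
    using assms coth_half_strict_antimono[of t tau] coth_half_strict_antimono[of tau t]
    by (cases t tau rule: linorder_cases) auto
qed

theorem theorem3p6:
  fixes b :: real
  assumes "b \<noteq> 0"
  shows "(\<exists>!t::real. t > 0 \<and> coth (t / 2) = t / 2) \<and> sigma_time b = ereal tau"
proof
  have tau: "tau > 0" using theI'[OF ex1_tau] unfolding tau_def by auto
  have "{t. t > 0 \<and>
     (\<Sum>\<^sub>\<infinity>n::int. \<Sum>\<^sub>\<infinity>k::nat.
        ennreal (exp (- t * ((b * of_int n)\<^sup>2 / 2 + of_nat k)))
          * L2_opnorm (spectral_proj (b * of_int n) k)) < \<infinity>} = {t. t > 0 \<and> tau < t}"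
  proof (intro Collect_cong conj_cong refl)
    fix t :: real assume t: "t > 0"
    then have "1 - exp (- t) > 0" by simp
    \<comment> \<open>The sum over k leaves a Gaussian sum with c = 1 - exp(-t) and s = coth(t/2) -
      t/2.\<close>
    from infsum_gaussian_int_finite_iff[OF assms this] coth_half_less_iff[OF t]
    show "((\<Sum>\<^sub>\<infinity>n::int. \<Sum>\<^sub>\<infinity>k::nat.
        ennreal (exp (- t * ((b * of_int n)\<^sup>2 / 2 + of_nat k)))
          * L2_opnorm (spectral_proj (b * of_int n) k)) < \<infinity>) \<longleftrightarrow> tau < t"
      by (simp only: infsum_opnorm_spectral_proj[OF t] diff_less_0_iff_less)
  qed
  also have "\<dots> = {tau<..}" using tau by auto
  finally have "sigma_time b = Inf (ereal ` {tau<..})"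
    by (simp only: sigma_time_def)
  also have "\<dots> = ereal tau"
  proof (rule Inf_eqI)
    fix y assume y: "\<And>z. z \<in> ereal ` {tau<..} \<Longrightarrow> y \<le> z"
    \<comment> \<open>\<open>tau\<close> itself is not an admissible time, so a lower bound is
      compared with the times tau + e.\<close>
    have "y \<le> ereal tau + ereal e" if "e > 0" for e
      using y[of "ereal (tau + e)"] that by simp
    then show "y \<le> ereal tau" by (rule ereal_le_epsilon2[rule_format]) auto
  qed auto
  finally show "sigma_time b = ereal tau" .
qed (rule ex1_tau)

end
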